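(* Let $H$ be a real Hilbert space, $K\ge 2$, and let $D_1,\dots,D_K\subset S(H)$ be dictionaries satisfying the standing assumptions stated in the context. Let $i(n)\in\{1,\dots,K\}$, $n=1,2,\dots$, be a sequence containing each $k\in\{1,\dots,K\}$ infinitely often and such that $i(n)\ne i(n+1)$ for all $n$. Let $x_0\in H$, let $x_n=G_{i(n)}x_{n-1}$ for $n\ge 1$, and let $W$ be the set of all partial weak limits of $\{x_n\}$. Then for each $w\in W$ with $w\neq 0$ there exists another element $w'\in W$ such that: (i) $|J(w')\setminus J(w)|\ge 1$; (ii) $|J(w')\cap J(w)|\ge 2$; (iii) $|J(w')|\ge 3$; (iv) $\langle w'-w,a\rangle\ge 0$ for every $a\in A_{J(w)}$. In particular, $|w'|^2\ge |w|^2+|w-w'|^2$ and $|w'|>|w|$.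
   Context: $\langle\cdot,\cdot\rangle$ and $|\cdot|$ denote the scalar product and the norm of $H$; for a finite set $J$, $|J|$ denotes its cardinality; $S(H)$ is the unit sphere of $H$. Standing assumptions on the dictionaries $D_1,\dots,D_K\subset S(H)$: (a) the union $\bigcup_{i=1}^K D_i$ is contained in no half-space, i.e. for any nonzero $v\in H$ there is $g\in\bigcup_{i=1}^K D_i$ with $\langle v,g\rangle>0$; (b) for each $x\in H$ and each $i\in\{1,\dots,K\}$, if $\sup_{g\in D_i}\langle x,g\rangle>0$, then this supremum is attained at some element of $D_i$. For $x\in H$: if $\sup_{g\in D_i}\langle x,g\rangle>0$, then $g_i(x)$ denotes an element of $D_i$ at which the supremum is attained (any one of them if there are several); if $\sup_{g\in D_i}\langle x,g\rangle\le 0$, then $g_i(x)=0$. The greedy step with respect to $D_i$ is $G_i(x)=x-\langle x,g_i(x)\rangle g_i(x)$. A partial weak limit of $\{x_n\}$ is the weak limit of some subsequence of $\{x_n\}$. Define the closed convex cones $A_i=\{y\in H:\langle y,g\rangle\le 0\text{ for all }g\in D_i\}$, $i=1,\dots,K$, and $A_J=\bigcap_{j\in J}A_j$ for $J\subset\{1,\dots,K\}$. For $w\in W$, $J(w)$ is the maximal subset of $\{1,\dots,K\}$ such that $w\in A_{J(w)}$, i.e. $J(w)=\{j: w\in A_j\}$. *)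

theory Defs
  imports "HOL-Analysis.Analysis"
begin

definition weakly_converges :: "(nat \<Rightarrow> 'a::real_inner) \<Rightarrow> 'a \<Rightarrow> bool" where
  "weakly_converges x w \<longleftrightarrow> (\<forall>y. (\<lambda>n. x n \<bullet> y) \<longlonglongrightarrow> w \<bullet> y)"

definition partial_weak_limits :: "(nat \<Rightarrow> 'a::real_inner) \<Rightarrow> 'a set" where
  "partial_weak_limits x = {w. \<exists>r. strict_mono r \<and> weakly_converges (x \<circ> r) w}"

text \<open>The supremum is taken in the extended reals, so it is minus infinity for an empty
  dictionary; on the reals, the supremum of the empty set would be an unspecified number.\<close>

definition dict_sup :: "'a::real_inner set \<Rightarrow> 'a \<Rightarrow> ereal" where
  "dict_sup D x = (SUP g\<in>D. ereal (x \<bullet> g))"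

definition sup_attained_at :: "'a::real_inner set \<Rightarrow> 'a \<Rightarrow> 'a \<Rightarrow> bool" where
  "sup_attained_at D x g \<longleftrightarrow> g \<in> D \<and> ereal (x \<bullet> g) = dict_sup D x"

text \<open>A function \<open>g\<close> selecting, for every point, one admissible greedy element of \<open>D\<close>; the choice
  among several maximizers is arbitrary.\<close>

definition greedy_selection :: "'a::real_inner set \<Rightarrow> ('a \<Rightarrow> 'a) \<Rightarrow> bool" where
  "greedy_selection D g \<longleftrightarrow>
     (\<forall>x. (dict_sup D x > 0 \<longrightarrow> sup_attained_at D x (g x)) \<and>
          (dict_sup D x \<le> 0 \<longrightarrow> g x = 0))"

definition greedy_step :: "('a::real_inner \<Rightarrow> 'a) \<Rightarrow> 'a \<Rightarrow> 'a" where
  "greedy_step g x = x - (x \<bullet> g x) *\<^sub>R g x"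

definition dict_cone :: "'a::real_inner set \<Rightarrow> 'a set" where
  "dict_cone D = {y. \<forall>g\<in>D. y \<bullet> g \<le> 0}"

definition dict_cone_Inter :: "(nat \<Rightarrow> 'a::real_inner set) \<Rightarrow> nat set \<Rightarrow> 'a set" where
  "dict_cone_Inter D J = (\<Inter>j\<in>J. dict_cone (D j))"

text \<open>The largest \<open>J \<subseteq> {1..K}\<close> with \<open>w \<in> dict_cone_Inter D J\<close>.\<close>

definition cone_indices :: "nat \<Rightarrow> (nat \<Rightarrow> 'a::real_inner set) \<Rightarrow> 'a \<Rightarrow> nat set" where
  "cone_indices K D w = {j\<in>{1..K}. w \<in> dict_cone (D j)}"

end

theory Submission
  imports Defs "HOL-Complex_Analysis.Great_Picard"
begin

text \<open>
  A greedy step lowers the squared norm by the square of its coefficient, so the coefficients are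
  square summable and tend to \<open>0\<close>. Two things follow. Consecutive iterates get arbitrarily close,
  so a weak limit along times \<open>s n\<close> is also a weak limit along \<open>s n - 1\<close>. And since the coefficient
  of a step dominates \<open>x n \<bullet> h\<close> for every \<open>h\<close> in the dictionary used, a dictionary used at (or
  boundedly near) the times \<open>s n\<close> infinitely often has the weak limit in its cone: eventually, every
  such index lies in \<open>J(w) = cone_indices K D w\<close> (\<open>eventually_index_in_cone_indices\<close>).

  Now let \<open>x (p n)\<close> tend weakly to \<open>w \<noteq> 0\<close>. Because no half-space contains all dictionaries,
  some index is outside \<open>J(w)\<close>, and it is used again after \<open>p n\<close>. Let \<open>q n \<ge> p n\<close> be the first
  time at which the next index is outside \<open>J(w)\<close>, and let \<open>w'\<close> be a weak limit of a subsequence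
  of \<open>x (q n)\<close>.
  Between \<open>p n\<close> and \<open>q n\<close> the iteration only subtracts nonnegative multiples of elements \<open>h\<close> with
  \<open>h \<bullet> a \<le> 0\<close> for all \<open>a\<close> in \<open>A_{J(w)}\<close>, so \<open>x \<bullet> a\<close> does not decrease; this is claim (iv). The index
  used right after \<open>q n\<close> lies in \<open>J(w')\<close> but not in \<open>J(w)\<close>. The last two indices used up to \<open>q n\<close> are
  distinct, lie in \<open>J(w')\<close>, and lie in \<open>J(w)\<close> as well: they were used either between \<open>p n\<close>
  and \<open>q n\<close> or immediately before \<open>p n\<close>. Counting gives (i)--(iii), and (iv) for \<open>a = w\<close>
  gives the norm inequalities.

  The existence of \<open>w'\<close> is weak sequential compactness of bounded sequences in a Hilbert space
  (\<open>bounded_weakly_convergent_subsequence\<close>). It is obtained here without duality: nested bounded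
  closed convex sets meet, and a point common to the closed convex hulls of all tails of a sequence
  is its weak limit as soon as the sequence converges against each of its own terms, which a
  diagonal argument achieves.
\<close>

section \<open>Weak sequential compactness in Hilbert spaces\<close>

text \<open>The distances of the sets from \<open>0\<close> increase to a limit \<open>d\<close>. The points of the \<open>n\<close>-th set whose
  norm exceeds \<open>d\<close> by at most \<open>1 / (n + 1)\<close> form slices whose diameters tend to \<open>0\<close> by the
  parallelogram law, so Cantor's theorem on nested closed sets applies to the slices.\<close>

lemma decreasing_closed_convex_Inter_nonempty:
  fixes C :: "nat \<Rightarrow> 'a::{real_inner, complete_space} set"
  assumes closed: "\<And>n. closed (C n)" and convex: "\<And>n. convex (C n)"
    and nonempty: "\<And>n. C n \<noteq> {}" and decr: "\<And>m n. m \<le> n \<Longrightarrow> C n \<subseteq> C m"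
    and bounded: "bounded (C 0)"
  shows "(\<Inter>n. C n) \<noteq> {}"
proof -
  define q where "q n = infdist 0 (C n)" for n
  obtain B where B: "\<And>u. u \<in> C 0 \<Longrightarrow> norm u \<le> B"
    using bounded by (auto simp: bounded_iff)
  have q_nonneg: "0 \<le> q n" for n
    by (simp add: q_def infdist_nonneg)
  have q_le: "q n \<le> norm u" if "u \<in> C n" for n u
    using infdist_le[OF that, of 0] by (simp add: q_def)
  have q_bound: "q n \<le> B" for n
  proof -
    obtain u where "u \<in> C n" using nonempty by blast
    then show ?thesis using q_le[of u n] B[of u] decr[of 0 n] by fastforce
  qed
  have "incseq q"
    unfolding q_def by (intro incseq_SucI infdist_mono decr nonempty) simp
  then obtain d where d: "q \<longlonglongrightarrow> d" and q_le_d: "\<And>n. q n \<le> d"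
    using incseq_convergent[of q B] q_bound by blast
  define r where "r n = d + 1 / real (Suc n)" for n
  define T where "T n = C n \<inter> cball 0 (r n)" for n
  define b where "b n = 4 * ((r n)\<^sup>2 - (q n)\<^sup>2)" for n
  have r_lim: "r \<longlonglongrightarrow> d"
    unfolding r_def using tendsto_add[OF tendsto_const LIMSEQ_Suc[OF lim_1_over_n], of d] by simp
  have "b \<longlonglongrightarrow> 4 * (d\<^sup>2 - d\<^sup>2)"
    unfolding b_def by (intro tendsto_intros r_lim d)
  then have b_lim: "b \<longlonglongrightarrow> 0" by simp
  have dist_T: "(dist u v)\<^sup>2 \<le> b n" if "u \<in> T n" "v \<in> T n" for u v n
  proof -
    have "(1/2) *\<^sub>R u + (1/2) *\<^sub>R v \<in> C n"
      using that convex[of n] by (intro convexD) (auto simp: T_def)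
    then have "q n \<le> norm ((1/2) *\<^sub>R (u + v))"
      using q_le by (metis scaleR_add_right)
    then have "2 * q n \<le> norm (u + v)" by simp
    then have 1: "(2 * q n)\<^sup>2 \<le> (norm (u + v))\<^sup>2"
      using q_nonneg[of n] by (intro power_mono) auto
    have 2: "(norm u)\<^sup>2 \<le> (r n)\<^sup>2" "(norm v)\<^sup>2 \<le> (r n)\<^sup>2"
      using that by (auto simp: T_def intro!: power_mono)
    have "(norm (u - v))\<^sup>2 + (norm (u + v))\<^sup>2 = 2 * (norm u)\<^sup>2 + 2 * (norm v)\<^sup>2"
      by (simp add: power2_norm_eq_inner inner_simps inner_commute)
    then show ?thesis
      using 1 2 by (simp add: b_def dist_norm power_mult_distrib)
  qed
  have "\<exists>a. \<forall>n. a \<in> T n"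
  proof (rule decreasing_closed_nest)
    show "closed (T n)" for n
      unfolding T_def by (intro closed_Int closed closed_cball)
    show "T n \<noteq> {}" for n
    proof -
      have "infdist 0 (C n) < r n"
        using q_le_d[of n] by (simp add: r_def q_def add_strict_increasing2 add.commute le_less_trans)
      then obtain u where "u \<in> C n" "dist 0 u < r n"
        using nonempty[of n] cInf_lessD[of "dist 0 ` C n" "r n"] by (auto simp: infdist_notempty)
      then show ?thesis by (auto simp: T_def)
    qed
    show "T n \<subseteq> T m" if "m \<le> n" for m n
    proof -
      have "r n \<le> r m" using that by (simp add: r_def frac_le)
      then show ?thesis using decr[OF that] by (auto simp: T_def)
    qed
    show "\<exists>n. \<forall>u\<in>T n. \<forall>v\<in>T n. dist u v < e" if "e > 0" for e
    proof -
      have "eventually (\<lambda>n. b n < e\<^sup>2) sequentially"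
        using order_tendstoD(2)[OF b_lim] that by simp
      then obtain n where "b n < e\<^sup>2"
        by (auto simp: eventually_sequentially)
      then have "(dist u v)\<^sup>2 < e\<^sup>2" if "u \<in> T n" "v \<in> T n" for u v
        using dist_T[OF that] by simp
      then show ?thesis
        using that power_less_imp_less_base[of _ 2 e] by (meson less_imp_le)
    qed
  qed blast
  then obtain a where "a \<in> T n" for n by blast
  then show ?thesis by (auto simp: T_def)
qed

definition tail_hulls :: "(nat \<Rightarrow> 'a::real_normed_vector) \<Rightarrow> 'a set" where
  "tail_hulls y = (\<Inter>n. closure (convex hull (y ` {n..})))"

lemma tail_hulls_nonempty:
  fixes y :: "nat \<Rightarrow> 'a::{real_inner, complete_space}"
  assumes "bounded (range y)"
  shows "tail_hulls y \<noteq> {}"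
  unfolding tail_hulls_def
proof (rule decreasing_closed_convex_Inter_nonempty)
  show "bounded (closure (convex hull (y ` {0..})))"
    using assms by (intro bounded_closure bounded_convex_hull) (simp add: atLeast_0)
  show "closure (convex hull (y ` {n..})) \<subseteq> closure (convex hull (y ` {m..}))" if "m \<le> n" for m n
    using that by (intro closure_mono hull_mono) auto
qed (auto simp: convex_closure)

lemma tail_hulls_subset:
  assumes "closed S" "convex S" "eventually (\<lambda>n. y n \<in> S) sequentially" "w \<in> tail_hulls y"
  shows "w \<in> S"
proof -
  obtain N where "y ` {N..} \<subseteq> S"
    using assms(3) by (auto simp: eventually_sequentially)
  then have "closure (convex hull (y ` {N..})) \<subseteq> S"
    using assms by (intro closure_minimal hull_minimal) auto
  then show ?thesis
    using assms(4) by (auto simp: tail_hulls_def)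
qed

text \<open>For \<open>e > 0\<close> the sequence is eventually in the closed half-space \<open>u \<bullet> v \<le> l + e\<close>, which
  therefore contains the tail hulls; the reverse inequality is the same statement for \<open>- v\<close>.\<close>

lemma tail_hulls_inner_eq:
  fixes y :: "nat \<Rightarrow> 'a::real_inner"
  assumes w: "w \<in> tail_hulls y" and lim: "(\<lambda>n. y n \<bullet> v) \<longlonglongrightarrow> l"
  shows "w \<bullet> v = l"
proof -
  have le: "w \<bullet> v \<le> l" if lim: "(\<lambda>n. y n \<bullet> v) \<longlonglongrightarrow> l" for v l
  proof (rule field_le_epsilon)
    fix e :: real assume "e > 0"
    have "eventually (\<lambda>n. y n \<bullet> v < l + e) sequentially"
      using order_tendstoD(2)[OF lim] \<open>e > 0\<close> by simp
    then have "eventually (\<lambda>n. y n \<in> {u. v \<bullet> u \<le> l + e}) sequentially"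
      by eventually_elim (simp add: inner_commute)
    then have "w \<in> {u. v \<bullet> u \<le> l + e}"
      by (rule tail_hulls_subset[OF closed_halfspace_le convex_halfspace_le _ w])
    then show "w \<bullet> v \<le> l + e" by (simp add: inner_commute)
  qed
  show ?thesis
    using le[OF lim] le[of "- v" "- l"] tendsto_minus[OF lim] by simp
qed

text \<open>A point \<open>w\<close> of the tail hulls of \<open>y\<close> has the right products with all \<open>y m\<close>. If
  some \<open>y n \<bullet> v\<close> failed to tend to \<open>w \<bullet> v\<close>, it would tend to another number along a subsequence.
  A point \<open>w'\<close> of the tail hulls of that subsequence has the same products with all \<open>y m\<close>, and both
  points lie in the closed span of the \<open>y m\<close>, so \<open>w' = w\<close>, a contradiction.\<close>

lemma weakly_converges_if_inner_self_convergent: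
  fixes y :: "nat \<Rightarrow> 'a::{real_inner, complete_space}"
  assumes bounded: "bounded (range y)"
    and conv: "\<And>m. convergent (\<lambda>n. y n \<bullet> y m)"
  obtains w where "weakly_converges y w"
proof -
  obtain w where w: "w \<in> tail_hulls y"
    using tail_hulls_nonempty[OF bounded] by blast
  have "(\<lambda>n. y n \<bullet> v) \<longlonglongrightarrow> w \<bullet> v" for v
  proof (rule ccontr)
    assume "\<not> (\<lambda>n. y n \<bullet> v) \<longlonglongrightarrow> w \<bullet> v"
    then obtain e where e: "e > 0"
      and "\<not> eventually (\<lambda>n. dist (y n \<bullet> v) (w \<bullet> v) < e) sequentially"
      by (auto simp: tendsto_iff)
    then have "infinite {n. \<not> dist (y n \<bullet> v) (w \<bullet> v) < e}"
      by (simp add: eventually_cofinite flip: cofinite_eq_sequentially)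
    then obtain r :: "nat \<Rightarrow> nat" where r: "strict_mono r"
      and far: "\<And>n. \<not> dist (y (r n) \<bullet> v) (w \<bullet> v) < e"
      using infinite_enumerate by blast
    have "bounded (range (\<lambda>n. y (r n) \<bullet> v))"
    proof -
      have "bounded ((\<lambda>u. u \<bullet> v) ` range y)"
        using bounded bounded_linear_inner_left by (rule bounded_linear_image)
      then show ?thesis by (rule bounded_subset) auto
    qed
    then obtain l s where s: "strict_mono (s :: nat \<Rightarrow> nat)"
      and l: "((\<lambda>n. y (r n) \<bullet> v) \<circ> s) \<longlonglongrightarrow> l"
      using bounded_imp_convergent_subsequence by blast
    define z where "z = y \<circ> r \<circ> s"
    have rs: "strict_mono (r \<circ> s)" using r s by (rule strict_mono_o)
    have "bounded (range z)"
      using bounded by (rule bounded_subset) (auto simp: z_def)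
    then obtain w' where w': "w' \<in> tail_hulls z"
      using tail_hulls_nonempty by blast
    have lv: "w' \<bullet> v = l"
      using l by (intro tail_hulls_inner_eq[OF w']) (simp add: z_def o_def)
    have eq: "(w - w') \<bullet> y m = 0" for m
    proof -
      obtain c where c: "(\<lambda>n. y n \<bullet> y m) \<longlonglongrightarrow> c"
        using conv by (auto simp: convergent_def)
      have "(\<lambda>n. z n \<bullet> y m) \<longlonglongrightarrow> c"
        using LIMSEQ_subseq_LIMSEQ[OF c rs] by (simp add: z_def o_def)
      then show ?thesis
        using tail_hulls_inner_eq[OF w c] tail_hulls_inner_eq[OF w'] by (simp add: inner_diff_left)
    qed
    let ?S = "{u. (w - w') \<bullet> u = 0}"
    have "w \<in> ?S"
      using eq by (intro tail_hulls_subset[OF closed_hyperplane convex_hyperplane _ w]) simp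
    moreover have "w' \<in> ?S"
      using eq by (intro tail_hulls_subset[OF closed_hyperplane convex_hyperplane _ w'])
        (simp add: z_def)
    ultimately have "(w - w') \<bullet> (w - w') = 0" by (simp add: inner_diff_right)
    then have "w' = w" by simp
    then have "eventually (\<lambda>n. dist (((\<lambda>n. y (r n) \<bullet> v) \<circ> s) n) (w \<bullet> v) < e) sequentially"
      using l lv e by (auto simp: tendsto_iff)
    then show False using far by (auto simp: eventually_sequentially)
  qed
  then show ?thesis using that by (auto simp: weakly_converges_def)
qed

text \<open>A diagonal argument gives convergence against the countably many terms of the sequence itself,
  and by the preceding lemma this already forces weak convergence.\<close>

lemma bounded_weakly_convergent_subsequence:
  fixes y :: "nat \<Rightarrow> 'a::{real_inner, complete_space}"
  assumes "bounded (range y)"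
  obtains r w where "strict_mono (r :: nat \<Rightarrow> nat)" "weakly_converges (y \<circ> r) w"
proof -
  obtain B where B: "\<And>n. norm (y n) \<le> B"
    using assms by (auto simp: bounded_iff)
  have le: "norm (y n \<bullet> u) \<le> B * B" if "u \<in> range y" for n u
  proof -
    have "norm (y n \<bullet> u) \<le> norm (y n) * norm u"
      by (simp add: Cauchy_Schwarz_ineq2)
    also have "\<dots> \<le> B * B"
      using that B norm_ge_zero order_trans by (intro mult_mono) blast+
    finally show ?thesis .
  qed
  obtain r where r: "strict_mono (r :: nat \<Rightarrow> nat)"
    and lim: "\<And>u. u \<in> range y \<Longrightarrow> \<exists>l. (\<lambda>n. y (r n) \<bullet> u) \<longlonglongrightarrow> l"
    using function_convergent_subsequence[of "range y" "\<lambda>n u. y n \<bullet> u" "B * B"] le by auto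
  have "bounded (range (y \<circ> r))"
    using assms by (rule bounded_subset) auto
  moreover have "convergent (\<lambda>n. (y \<circ> r) n \<bullet> (y \<circ> r) m)" for m
    using lim[of "y (r m)"] by (simp add: convergent_def)
  ultimately show ?thesis
    using weakly_converges_if_inner_self_convergent that r by blast
qed

lemma weakly_converges_subseq:
  assumes "weakly_converges y w" "strict_mono r"
  shows "weakly_converges (y \<circ> r) w"
  unfolding weakly_converges_def
proof
  fix v
  have "(\<lambda>n. y n \<bullet> v) \<longlonglongrightarrow> w \<bullet> v"
    using assms(1) by (simp add: weakly_converges_def)
  from LIMSEQ_subseq_LIMSEQ[OF this assms(2)]
  show "(\<lambda>n. (y \<circ> r) n \<bullet> v) \<longlonglongrightarrow> w \<bullet> v" by (simp add: o_def)
qed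

lemma weakly_converges_perturb:
  assumes "weakly_converges y w" and lim: "(\<lambda>n. z n - y n) \<longlonglongrightarrow> 0"
  shows "weakly_converges z w"
  unfolding weakly_converges_def
proof
  fix v
  have "(\<lambda>n. y n \<bullet> v + (z n - y n) \<bullet> v) \<longlonglongrightarrow> w \<bullet> v + 0 \<bullet> v"
    using assms(1)
    by (intro tendsto_add tendsto_inner[OF lim tendsto_const]) (simp add: weakly_converges_def)
  then show "(\<lambda>n. z n \<bullet> v) \<longlonglongrightarrow> w \<bullet> v"
    by (simp add: inner_diff_left)
qed

lemma filterlim_strict_mono_subseq:
  fixes m :: "nat \<Rightarrow> nat"
  assumes "filterlim m at_top sequentially"
  obtains t where "strict_mono (t :: nat \<Rightarrow> nat)" "strict_mono (m \<circ> t)"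
proof -
  have "\<exists>l>k. m l > m k" for k
  proof -
    have "eventually (\<lambda>l. m l > m k) sequentially"
      using assms by (auto simp: filterlim_at_top Suc_le_eq dest!: spec[of _ "Suc (m k)"])
    then have "eventually (\<lambda>l. l > k \<and> m l > m k) sequentially"
      using eventually_gt_at_top by (rule eventually_conj[rotated])
    then show ?thesis by (auto simp: eventually_sequentially)
  qed
  then obtain f where "\<And>k. f k > k \<and> m (f k) > m k" by metis
  then have "strict_mono (\<lambda>n. (f ^^ n) 0)" "strict_mono (m \<circ> (\<lambda>n. (f ^^ n) 0))"
    by (auto simp: strict_mono_Suc_iff)
  then show ?thesis using that by blast
qed

section \<open>A single greedy step\<close>

lemma greedy_selection_cases:
  assumes "greedy_selection D g" "D \<subseteq> sphere 0 1"
  obtains "x \<bullet> g x > 0" "g x \<in> D" "norm (g x) = 1" "\<And>h. h \<in> D \<Longrightarrow> x \<bullet> h \<le> x \<bullet> g x"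
    | "g x = 0" "\<And>h. h \<in> D \<Longrightarrow> x \<bullet> h \<le> 0"
proof (cases "dict_sup D x > 0")
  case True
  then have "g x \<in> D" and eq: "ereal (x \<bullet> g x) = dict_sup D x"
    using assms(1) by (auto simp: greedy_selection_def sup_attained_at_def)
  moreover have "x \<bullet> g x > 0"
    using True by (simp flip: eq)
  moreover have "x \<bullet> h \<le> x \<bullet> g x" if "h \<in> D" for h
  proof -
    have "ereal (x \<bullet> h) \<le> dict_sup D x"
      unfolding dict_sup_def using that by (rule SUP_upper)
    then show ?thesis by (simp flip: eq)
  qed
  ultimately show ?thesis using that(1) assms(2) by (auto simp: subset_iff)
next
  case False
  then have le: "dict_sup D x \<le> 0" by simp
  have "x \<bullet> h \<le> 0" if "h \<in> D" for h
  proof -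
    have "ereal (x \<bullet> h) \<le> 0"
      using SUP_upper[OF that, of "\<lambda>h. ereal (x \<bullet> h)"] le
      unfolding dict_sup_def by (rule order_trans)
    then show ?thesis by simp
  qed
  moreover have "g x = 0"
    using le assms(1) by (simp add: greedy_selection_def)
  ultimately show ?thesis using that(2) by blast
qed

context
  fixes D :: "'a::real_inner set" and g :: "'a \<Rightarrow> 'a"
  assumes sel: "greedy_selection D g" and unit: "D \<subseteq> sphere 0 1"
begin

lemma inner_le_greedy_coeff: "h \<in> D \<Longrightarrow> x \<bullet> h \<le> x \<bullet> g x"
  by (rule greedy_selection_cases[OF sel unit, of x]) auto

lemma norm_greedy_step_diff: "norm (greedy_step g x - x) = x \<bullet> g x"
  by (rule greedy_selection_cases[OF sel unit, of x]) (auto simp: greedy_step_def)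

lemma norm_greedy_step: "(norm (greedy_step g x))\<^sup>2 = (norm x)\<^sup>2 - (x \<bullet> g x)\<^sup>2"
proof (rule greedy_selection_cases[OF sel unit, of x])
  assume "norm (g x) = 1"
  then have "g x \<bullet> g x = 1" by (simp add: dot_square_norm)
  then show ?thesis
    unfolding greedy_step_def power2_norm_eq_inner
    by (simp add: inner_simps inner_commute power2_eq_square)
qed (simp add: greedy_step_def)

lemma greedy_step_inner_cone:
  assumes "a \<in> dict_cone D"
  shows "x \<bullet> a \<le> greedy_step g x \<bullet> a"
proof (rule greedy_selection_cases[OF sel unit, of x])
  assume "g x \<in> D" "x \<bullet> g x > 0"
  then have "(x \<bullet> g x) * (g x \<bullet> a) \<le> 0"
    using assms by (intro mult_nonneg_nonpos) (auto simp: dict_cone_def inner_commute)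
  then show ?thesis by (simp add: greedy_step_def inner_diff_left)
qed (simp add: greedy_step_def)

end

section \<open>Greedy iterations over several dictionaries\<close>

text \<open>Time is shifted by one against the coefficients: the step leading from \<open>x n\<close> to \<open>x (Suc n)\<close>
  uses the dictionary with index \<open>i (Suc n)\<close>.\<close>

locale greedy_iteration =
  fixes K :: nat and D :: "nat \<Rightarrow> 'a::{real_inner, complete_space} set"
    and g :: "nat \<Rightarrow> 'a \<Rightarrow> 'a" and i :: "nat \<Rightarrow> nat" and x :: "nat \<Rightarrow> 'a"
  assumes unit: "k \<in> {1..K} \<Longrightarrow> D k \<subseteq> sphere 0 1"
    and sel: "k \<in> {1..K} \<Longrightarrow> greedy_selection (D k) (g k)"
    and index: "i (Suc n) \<in> {1..K}"
    and step: "x (Suc n) = greedy_step (g (i (Suc n))) (x n)"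
begin

definition coeff :: "nat \<Rightarrow> real" where
  "coeff n = x n \<bullet> g (i (Suc n)) (x n)"

lemmas sel_Suc = sel[OF index] and unit_Suc = unit[OF index]

lemma norm_Suc: "(norm (x (Suc n)))\<^sup>2 = (norm (x n))\<^sup>2 - (coeff n)\<^sup>2"
  unfolding step coeff_def by (rule norm_greedy_step[OF sel_Suc unit_Suc])

lemma norm_decseq: "decseq (\<lambda>n. (norm (x n))\<^sup>2)"
  by (intro decseq_SucI) (simp add: norm_Suc)

lemma bounded_range: "bounded (range x)"
proof -
  have "(norm (x n))\<^sup>2 \<le> (norm (x 0))\<^sup>2" for n
    using decseqD[OF norm_decseq, of 0 n] by simp
  then have "norm (x n) \<le> norm (x 0)" for n
    by (rule power2_le_imp_le) simp
  then show ?thesis by (auto simp: bounded_iff)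
qed

lemma coeff_tendsto_0: "coeff \<longlonglongrightarrow> 0"
proof -
  obtain L where L: "(\<lambda>n. (norm (x n))\<^sup>2) \<longlonglongrightarrow> L"
    using decseq_convergent[OF norm_decseq, of 0] by auto
  have "(\<lambda>n. (norm (x n))\<^sup>2 - (norm (x (Suc n)))\<^sup>2) \<longlonglongrightarrow> L - L"
    by (intro tendsto_diff L LIMSEQ_Suc[OF L])
  then have "(\<lambda>n. (coeff n)\<^sup>2) \<longlonglongrightarrow> 0" by (simp add: norm_Suc)
  then have "(\<lambda>n. sqrt ((coeff n)\<^sup>2)) \<longlonglongrightarrow> sqrt 0" by (rule tendsto_real_sqrt)
  then show ?thesis by (simp add: tendsto_rabs_zero_iff)
qed

lemma weakly_converges_pred:
  assumes s: "filterlim s at_top sequentially" and w: "weakly_converges (x \<circ> s) w"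
  shows "weakly_converges (x \<circ> (\<lambda>n. s n - 1)) w"
proof (rule weakly_converges_perturb[OF w])
  have diff: "norm (x (Suc n) - x n) = coeff n" for n
    unfolding step coeff_def by (rule norm_greedy_step_diff[OF sel_Suc unit_Suc])
  have "filterlim (\<lambda>n. s n - 1) at_top sequentially"
    using filterlim_compose[OF filterlim_minus_const_nat_at_top s] .
  then have "(\<lambda>n. coeff (s n - 1)) \<longlonglongrightarrow> 0"
    by (rule filterlim_compose[OF coeff_tendsto_0])
  moreover have "eventually (\<lambda>n. s n \<ge> 1) sequentially"
    using s by (simp add: filterlim_at_top)
  then have "eventually (\<lambda>n. norm ((x \<circ> (\<lambda>n. s n - 1)) n - (x \<circ> s) n) \<le> coeff (s n - 1)) sequentially"
  proof eventually_elim
    case (elim n)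
    then show ?case using diff[of "s n - 1"] by (simp add: norm_minus_commute)
  qed
  ultimately show "(\<lambda>n. (x \<circ> (\<lambda>n. s n - 1)) n - (x \<circ> s) n) \<longlonglongrightarrow> 0"
    by (rule Lim_null_comparison[rotated])
qed

text \<open>If \<open>k \<notin> J(w)\<close>, some \<open>h \<in> D k\<close> has \<open>w \<bullet> h > 0\<close>, so \<open>x (s n) \<bullet> h\<close> stays away from \<open>0\<close>
  and eventually exceeds the coefficient of the next step, which therefore cannot use \<open>D k\<close>.\<close>

lemma eventually_index_in_cone_indices:
  assumes s: "filterlim s at_top sequentially" and w: "weakly_converges (x \<circ> s) w"
  shows "eventually (\<lambda>n. i (Suc (s n)) \<in> cone_indices K D w) sequentially"
proof -
  have "eventually (\<lambda>n. i (Suc (s n)) \<noteq> k) sequentially" if k: "k \<in> {1..K} - cone_indices K D w" for k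
  proof -
    obtain h where h: "h \<in> D k" "w \<bullet> h > 0"
      using k by (auto simp: cone_indices_def dict_cone_def not_le)
    have "(\<lambda>n. x (s n) \<bullet> h - coeff (s n)) \<longlonglongrightarrow> w \<bullet> h - 0"
      using w by (intro tendsto_diff filterlim_compose[OF coeff_tendsto_0 s])
        (simp add: weakly_converges_def)
    then have "eventually (\<lambda>n. x (s n) \<bullet> h - coeff (s n) > 0) sequentially"
      using h by (intro order_tendstoD(1)) simp_all
    then show ?thesis
    proof eventually_elim
      case (elim n)
      then show ?case
        using inner_le_greedy_coeff[OF sel_Suc unit_Suc, of h "s n" "x (s n)"] h(1)
        by (auto simp: coeff_def)
    qed
  qed
  then have "eventually (\<lambda>n. \<forall>k\<in>{1..K} - cone_indices K D w. i (Suc (s n)) \<noteq> k) sequentially"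
    by (intro eventually_ball_finite) auto
  then show ?thesis
    by eventually_elim (use index in blast)
qed

corollary eventually_index_at_in_cone_indices:
  assumes s: "filterlim s at_top sequentially" and w: "weakly_converges (x \<circ> s) w"
  shows "eventually (\<lambda>n. i (s n) \<in> cone_indices K D w) sequentially"
proof -
  have "filterlim (\<lambda>n. s n - 1) at_top sequentially"
    using filterlim_compose[OF filterlim_minus_const_nat_at_top s] .
  then have "eventually (\<lambda>n. i (Suc (s n - 1)) \<in> cone_indices K D w) sequentially"
    by (rule eventually_index_in_cone_indices) (rule weakly_converges_pred[OF s w])
  moreover have "eventually (\<lambda>n. s n \<ge> 1) sequentially"
    using s by (simp add: filterlim_at_top)
  ultimately show ?thesis by eventually_elim simp
qed

lemma inner_cone_mono:
  assumes "p \<le> q" and "\<And>n. p \<le> n \<Longrightarrow> n < q \<Longrightarrow> i (Suc n) \<in> J" and a: "a \<in> dict_cone_Inter D J"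
  shows "x p \<bullet> a \<le> x q \<bullet> a"
  using assms(1,2)
proof (induction rule: dec_induct)
  case (step n)
  have "a \<in> dict_cone (D (i (Suc n)))"
    using a step by (auto simp: dict_cone_Inter_def)
  then have "x n \<bullet> a \<le> x (Suc n) \<bullet> a"
    unfolding greedy_iteration.step[OF greedy_iteration_axioms, of n]
    by (rule greedy_step_inner_cone[OF sel_Suc unit_Suc])
  moreover have "x p \<bullet> a \<le> x n \<bullet> a" using step by simp
  ultimately show ?case by simp
qed simp

text \<open>Several times \<open>r n\<close> may share the same exit from \<open>J\<close>, so a first subsequence makes the exit
  times strictly increasing; a second one makes the iterates at the exits converge weakly.\<close>

lemma exit_times:
  assumes k: "k \<notin> J" "infinite {n. n \<ge> 1 \<and> i n = k}"
    and r: "strict_mono r" and w: "weakly_converges (x \<circ> r) w"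
  obtains p q w' where "strict_mono p" "weakly_converges (x \<circ> p) w"
    "strict_mono q" "weakly_converges (x \<circ> q) w'"
    "\<And>n. p n \<le> q n" "\<And>n. i (Suc (q n)) \<notin> J"
    "\<And>n m. p n \<le> m \<Longrightarrow> m < q n \<Longrightarrow> i (Suc m) \<in> J"
proof -
  have ex: "\<exists>m\<ge>N. i (Suc m) \<notin> J" for N
  proof -
    obtain n where "n > N" "i n = k"
      using k(2) by (auto simp: infinite_nat_iff_unbounded)
    then show ?thesis using k(1) by (intro exI[of _ "n - 1"]) auto
  qed
  define m where "m n = (LEAST m. m \<ge> r n \<and> i (Suc m) \<notin> J)" for n
  have m: "m n \<ge> r n \<and> i (Suc (m n)) \<notin> J" for n
    unfolding m_def by (rule LeastI_ex) (use ex in auto)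
  have before_m: "i (Suc l) \<in> J" if "r n \<le> l" "l < m n" for n l
    using not_less_Least[of l "\<lambda>m. m \<ge> r n \<and> i (Suc m) \<notin> J"] that by (auto simp: m_def)
  have "filterlim m at_top sequentially"
    using filterlim_subseq[OF r] by (rule filterlim_at_top_mono) (simp add: m)
  then obtain t where t: "strict_mono (t :: nat \<Rightarrow> nat)" "strict_mono (m \<circ> t)"
    by (rule filterlim_strict_mono_subseq)
  have "bounded (range (x \<circ> (m \<circ> t)))"
    using bounded_range by (rule bounded_subset) auto
  then obtain u w' where u: "strict_mono (u :: nat \<Rightarrow> nat)"
    and w': "weakly_converges (x \<circ> (m \<circ> t) \<circ> u) w'"
    by (rule bounded_weakly_convergent_subsequence)
  have tu: "strict_mono (t \<circ> u)" using t(1) u by (rule strict_mono_o)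
  show ?thesis
  proof
    show "strict_mono (r \<circ> (t \<circ> u))" using r tu by (rule strict_mono_o)
    show "weakly_converges (x \<circ> (r \<circ> (t \<circ> u))) w"
      using weakly_converges_subseq[OF w tu] by (simp add: o_assoc)
    show "strict_mono (m \<circ> (t \<circ> u))" using strict_mono_o[OF t(2) u] by (simp add: o_assoc)
    show "weakly_converges (x \<circ> (m \<circ> (t \<circ> u))) w'" using w' by (simp add: o_assoc)
  qed (use m before_m in auto)
qed

text \<open>The three indices \<open>i (q n - 1)\<close>, \<open>i (q n)\<close>, \<open>i (Suc (q n))\<close> for one sufficiently large \<open>n\<close>
  witness the claims about \<open>J(w')\<close>.\<close>

lemma exit_limit:
  assumes alternate: "\<And>n. n \<ge> 1 \<Longrightarrow> i n \<noteq> i (Suc n)"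
    and k: "k \<notin> cone_indices K D w" "infinite {n. n \<ge> 1 \<and> i n = k}"
    and w: "w \<in> partial_weak_limits x"
  obtains w' a b c where "w' \<in> partial_weak_limits x"
    "a \<in> cone_indices K D w' \<inter> cone_indices K D w"
    "b \<in> cone_indices K D w' \<inter> cone_indices K D w"
    "a \<noteq> b" "c \<in> cone_indices K D w' - cone_indices K D w"
    "\<And>v. v \<in> dict_cone_Inter D (cone_indices K D w) \<Longrightarrow> w \<bullet> v \<le> w' \<bullet> v"
proof -
  let ?J = "cone_indices K D w"
  obtain r where "strict_mono r" "weakly_converges (x \<circ> r) w"
    using w by (auto simp: partial_weak_limits_def)
  then obtain p q w' where p: "strict_mono p" "weakly_converges (x \<circ> p) w"
    and q: "strict_mono q" "weakly_converges (x \<circ> q) w'"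
    and le: "\<And>n. p n \<le> q n" and exit: "\<And>n. i (Suc (q n)) \<notin> ?J"
    and between: "\<And>n m. p n \<le> m \<Longrightarrow> m < q n \<Longrightarrow> i (Suc m) \<in> ?J"
    using exit_times[OF k] by metis
  note p_lim = filterlim_subseq[OF p(1)] and q_lim = filterlim_subseq[OF q(1)]
  have q1_lim: "filterlim (\<lambda>n. q n - 1) at_top sequentially"
    using filterlim_compose[OF filterlim_minus_const_nat_at_top q_lim] .
  have "eventually (\<lambda>n. q n \<ge> 2 \<and> i (p n) \<in> ?J \<and> i (Suc (p n)) \<in> ?J \<and>
      i (Suc (q n)) \<in> cone_indices K D w' \<and> i (q n) \<in> cone_indices K D w' \<and>
      i (q n - 1) \<in> cone_indices K D w') sequentially"
    using q_lim
    by (intro eventually_conj eventually_index_in_cone_indices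
        eventually_index_at_in_cone_indices p_lim p(2) q_lim q(2) q1_lim
        weakly_converges_pred) (simp add: filterlim_at_top)
  then obtain n where n: "q n \<ge> 2" "i (p n) \<in> ?J" "i (Suc (p n)) \<in> ?J"
    and in': "i (Suc (q n)) \<in> cone_indices K D w'" "i (q n) \<in> cone_indices K D w'"
      "i (q n - 1) \<in> cone_indices K D w'"
    by (auto simp: eventually_sequentially)
  \<comment> \<open>The step after \<open>p n\<close> still uses an index in \<open>J(w)\<close>, so the exit happens strictly later.\<close>
  have "p n \<noteq> q n" using n(3) exit[of n] by auto
  then have less: "p n < q n" using le[of n] by simp
  then have last: "i (q n) \<in> ?J"
    using between[of n "q n - 1"] by simp
  have last2: "i (q n - 1) \<in> ?J"
  proof (cases "p n = q n - 1")
    case True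
    then show ?thesis using n(2) by simp
  next
    case False
    then show ?thesis using between[of n "q n - 2"] less n(1)
      by (simp add: numeral_2_eq_2 Suc_diff_Suc)
  qed
  show ?thesis
  proof
    show "w' \<in> partial_weak_limits x"
      using q by (auto simp: partial_weak_limits_def)
    show "i (q n - 1) \<in> cone_indices K D w' \<inter> ?J" "i (q n) \<in> cone_indices K D w' \<inter> ?J"
      "i (Suc (q n)) \<in> cone_indices K D w' - ?J"
      using in' last last2 exit by auto
    show "i (q n - 1) \<noteq> i (q n)"
      using alternate[of "q n - 1"] n(1) by simp
    show "w \<bullet> v \<le> w' \<bullet> v" if v: "v \<in> dict_cone_Inter D ?J" for v
    proof (rule LIMSEQ_le)
      show "(\<lambda>n. x (p n) \<bullet> v) \<longlonglongrightarrow> w \<bullet> v" "(\<lambda>n. x (q n) \<bullet> v) \<longlonglongrightarrow> w' \<bullet> v"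
        using p(2) q(2) by (auto simp: weakly_converges_def)
      show "\<exists>N. \<forall>n\<ge>N. x (p n) \<bullet> v \<le> x (q n) \<bullet> v"
        using inner_cone_mono[OF le _ v] between by metis
    qed
  qed
qed

end

section \<open>Larger partial weak limits\<close>

lemma cone_indices_finite: "finite (cone_indices K D w)"
  by (simp add: cone_indices_def)

lemma mem_dict_cone_Inter_cone_indices: "w \<in> dict_cone_Inter D (cone_indices K D w)"
  by (auto simp: dict_cone_Inter_def cone_indices_def)

theorem theorem3:
  fixes D :: "nat \<Rightarrow> 'a::{real_inner, complete_space} set"
    and K :: nat
    and g :: "nat \<Rightarrow> 'a \<Rightarrow> 'a"
    and i :: "nat \<Rightarrow> nat"
    and x0 :: 'a
    and x :: "nat \<Rightarrow> 'a"
  assumes "K \<ge> 2"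
    and "\<forall>k\<in>{1..K}. D k \<subseteq> sphere 0 1"
    and "\<forall>v. v \<noteq> 0 \<longrightarrow> (\<exists>h\<in>(\<Union>k\<in>{1..K}. D k). v \<bullet> h > 0)"
    and "\<forall>y. \<forall>k\<in>{1..K}. dict_sup (D k) y > 0 \<longrightarrow> (\<exists>h. sup_attained_at (D k) y h)"
    and "\<forall>k\<in>{1..K}. greedy_selection (D k) (g k)"
    and "\<forall>n\<ge>1. i n \<in> {1..K}"
    and "\<forall>k\<in>{1..K}. infinite {n. n \<ge> 1 \<and> i n = k}"
    and "\<forall>n\<ge>1. i n \<noteq> i (n + 1)"
    and "x 0 = x0"
    and "\<forall>n\<ge>1. x n = greedy_step (g (i n)) (x (n - 1))"
  shows "\<forall>w\<in>partial_weak_limits x. w \<noteq> 0 \<longrightarrow>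
    (\<exists>w'\<in>partial_weak_limits x.
        w' \<noteq> w \<and>
        card (cone_indices K D w' - cone_indices K D w) \<ge> 1 \<and>
        card (cone_indices K D w' \<inter> cone_indices K D w) \<ge> 2 \<and>
        card (cone_indices K D w') \<ge> 3 \<and>
        (\<forall>a\<in>dict_cone_Inter D (cone_indices K D w). (w' - w) \<bullet> a \<ge> 0) \<and>
        (norm w')\<^sup>2 \<ge> (norm w)\<^sup>2 + (norm (w - w'))\<^sup>2 \<and>
        norm w' > norm w)"
proof (intro ballI impI)
  fix w assume w: "w \<in> partial_weak_limits x" and "w \<noteq> 0"
  interpret greedy_iteration K D g i x
    by unfold_locales (use assms in auto)
  let ?J = "cone_indices K D"
  obtain k h where kh: "k \<in> {1..K}" "h \<in> D k" "w \<bullet> h > 0"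
    using assms(3) \<open>w \<noteq> 0\<close> by blast
  then have k: "k \<notin> ?J w"
    by (force simp: cone_indices_def dict_cone_def)
  have alternate: "i n \<noteq> i (Suc n)" if "n \<ge> 1" for n
    using assms(8) that by simp
  have "infinite {n. n \<ge> 1 \<and> i n = k}" using assms(7) kh(1) by blast
  from exit_limit[OF alternate k this w]
  obtain w' a b c where w': "w' \<in> partial_weak_limits x"
    and ab: "a \<in> ?J w' \<inter> ?J w" "b \<in> ?J w' \<inter> ?J w" "a \<noteq> b" and c: "c \<in> ?J w' - ?J w"
    and mono: "\<And>v. v \<in> dict_cone_Inter D (?J w) \<Longrightarrow> w \<bullet> v \<le> w' \<bullet> v"
    by metis
  have "w' \<noteq> w" using c by auto
  moreover have new: "card (?J w' - ?J w) \<ge> 1"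
    using card_mono[of "?J w' - ?J w" "{c}"] c by (simp add: cone_indices_finite)
  moreover have common: "card (?J w' \<inter> ?J w) \<ge> 2"
    using card_mono[of "?J w' \<inter> ?J w" "{a, b}"] ab by (simp add: cone_indices_finite)
  moreover have "card (?J w') \<ge> 3"
    using new common card_Int_Diff[OF cone_indices_finite, of K D w' "?J w"] by simp
  moreover have "\<forall>v\<in>dict_cone_Inter D (?J w). (w' - w) \<bullet> v \<ge> 0"
    using mono by (simp add: inner_diff_left)
  moreover have ineq: "(norm w')\<^sup>2 \<ge> (norm w)\<^sup>2 + (norm (w - w'))\<^sup>2"
    using mono[OF mem_dict_cone_Inter_cone_indices]
    by (simp add: power2_norm_eq_inner inner_simps inner_commute)
  moreover have "norm w' > norm w"
  proof (rule power2_less_imp_less)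
    have "(norm (w - w'))\<^sup>2 > 0" using \<open>w' \<noteq> w\<close> by simp
    then show "(norm w)\<^sup>2 < (norm w')\<^sup>2" using ineq by linarith
  qed simp
  ultimately show "\<exists>w'\<in>partial_weak_limits x.
        w' \<noteq> w \<and>
        card (?J w' - ?J w) \<ge> 1 \<and>
        card (?J w' \<inter> ?J w) \<ge> 2 \<and>
        card (?J w') \<ge> 3 \<and>
        (\<forall>a\<in>dict_cone_Inter D (?J w). (w' - w) \<bullet> a \<ge> 0) \<and>
        (norm w')\<^sup>2 \<ge> (norm w)\<^sup>2 + (norm (w - w'))\<^sup>2 \<and>
        norm w' > norm w"
    using w' by blast
qed

end
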